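(* Let $\mathcal R^q:\mathcal A^{\mathbb N}\to\mathcal A^{\mathbb N}$ be the $\mathcal A$-module endomorphism $P\mapsto\hat P$ given, for $\alpha\ge0$, $\beta\ge1$ and with $p_{-1}^q=p_{-1}^m=0$, by $$\hat p_0=u_xp_0+p_1^r,\quad \hat p_\alpha^q=q_{\alpha,x}p_0+p_{\alpha-1}^q,\quad \hat p_\alpha^m=m_{\alpha,x}p_0-\frac1t\,p_{\alpha-1}^m-\frac zt\,p_\alpha^m,\quad \hat p_\beta^r=r_{\beta,x}p_0-p_{\beta+1}^r,$$ let $\mathcal R^m=t\,\mathcal R^q+z\,\mathcal I$, where $\mathcal I$ is the identity map of $\mathcal A^{\mathbb N}$, and let $(\mathcal R^q)^{-1}$ and $(\mathcal R^m)^{-1}$ be their inverse maps (given by the formulas in the context). Then the $\mathcal A$-module endomorphisms $\mathcal R^q$, $\mathcal R^m$, $(\mathcal R^q)^{-1}$ and $(\mathcal R^m)^{-1}$ of $\mathcal A^{\mathbb N}$ pairwise commute.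
   Context: **Coordinates.** The space $\tilde{\mathcal E}^W$ (a covering of the reduced quasi-classical self-dual Yang-Mills equation $u_{yz}=u_{tx}-u_zu_{xx}+u_xu_{xz}$) has (internal) coordinates: $x,y,z,t$; $u_{x^it^j}$ ($i,j\ge0$), $u_{x^iy^kt^j}$ and $u_{x^iz^lt^j}$ ($i,j\ge 0$, $k,l\ge1$); $q_\alpha^{a,b}$, $m_\alpha^{a,b}$ ($\alpha,a,b\ge0$); $r_\beta^{a,b}$ ($\beta\ge1$, $a,b\ge0$). Write $u=u_{x^0t^0}$, $r_\beta=r_\beta^{0,0}$, and set $r_0=-u$. **The functions $q_{\alpha,x}, m_{\alpha,x}, r_{\beta,x}$.** $q_{\alpha,x}=q_\alpha^{1,0}$ and $m_{\alpha,x}=m_\alpha^{1,0}$ are coordinates. The functions $r_{\beta,x}$ are polynomials in the coordinates defined inductively by $r_{0,x}=-u_x$ and $r_{\beta,x}=u_xr_{\beta-1,x}-r_{\beta-1,y}$ for $\beta\ge1$, where $r_{0,y}=-u_y$ and $r_{\beta,y}=r_\beta^{1,0}$ for $\beta\ge1$. **The algebra $\mathcal A$.** $\mathcal A$ is the commutative $\mathbb R$-algebra generated by $\mathcal L\cup\mathcal F$, where $\mathcal F$ is the algebra of smooth functions of (finitely many of) the internal coordinates on $\tilde{\mathcal E}^W$ and $\mathcal L$ is the algebra of Laurent polynomials with real coefficients in (finitely many of) the internal coordinates. Elements of $\mathcal A$ are smooth functions defined where the finitely many inverted coordinates are nonzero, two being identified if they agree on such a common dense open set. $\mathcal A^{\mathbb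 N}$ is the $\mathcal A$-module of all sequences of elements of $\mathcal A$, written $P=[p_0,p_0^q,p_0^m,p_1^r,p_1^q,p_1^m,p_2^r,p_2^q,p_2^m,\ldots]$. **Inverse maps.** $\mathcal R^q$ and $\mathcal R^m$ are bijective on $\mathcal A^{\mathbb N}$; with $\hat p_0^r=-\hat p_0$, $\alpha\ge0$, $\beta\ge1$, the inverses $\hat P\mapsto P$ are as follows. For $(\mathcal R^q)^{-1}$: $$p_0=\frac{\hat p_0^q}{q_{0,x}},\qquad p_\alpha^q=-\frac{q_{\alpha+1,x}}{q_{0,x}}\hat p_0^q+\hat p_{\alpha+1}^q,$$ $$p_\alpha^m=\sum_{j=0}^\alpha\frac{t\,\hat p_j^m}{(-z)^{\alpha-j+1}}-\frac{t\,\hat p_0^q}{q_{0,x}}\sum_{j=0}^\alpha\frac{m_{j,x}}{(-z)^{\alpha-j+1}},\qquad p_\beta^r=\frac{r_{\beta-1,x}}{q_{0,x}}\hat p_0^q-\hat p_{\beta-1}^r.$$ For $(\mathcal R^m)^{-1}$: $$p_0=\frac{\hat p_0^m}{t\,m_{0,x}},\qquad p_\alpha^q=\sum_{j=0}^\alpha\frac{(-t)^{\alpha-j}\hat p_j^q}{z^{\alpha-j+1}}-\frac{\hat p_0^m}{m_{0,x}}\sum_{j=0}^\alpha\frac{(-t)^{\alpha-j}q_{j,x}}{z^{\alpha-j+1}},$$ $$p_\alpha^m=\frac{m_{\alpha+1,x}}{m_{0,x}}\hat p_0^m-\hat p_{\alpha+1}^m,\qquad p_\beta^r=-\sum_{j=0}^{\beta-1}\frac{z^{\beta-j-1}\hat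 p_j^r}{t^{\beta-j}}+\frac{\hat p_0^m}{m_{0,x}}\left(-\frac{z^\beta}{t^{\beta+1}}+\sum_{j=1}^{\beta}\frac{z^{\beta-j}r_{j-1,x}}{t^{\beta-j+1}}\right).$$ *)

theory Defs
  imports "HOL-Analysis.Analysis" "HOL-Library.Function_Algebras"
begin

section \<open>Internal coordinates\<close>

text \<open>
  Indices that start at 1 are stored shifted down by one, so that there are no junk coordinates:
  \<open>Cuy i k j\<close> is \<open>u_{x^i y^{k+1} t^j}\<close>, \<open>Cuz i l j\<close> is \<open>u_{x^i z^{l+1} t^j}\<close> and
  \<open>Cr b a c\<close> is \<open>r_{b+1}^{a,c}\<close>; whereas \<open>Cu i j\<close> is \<open>u_{x^i t^j}\<close>, \<open>Cq \<alpha> a b\<close> is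
  \<open>q_\<alpha>^{a,b}\<close> and \<open>Cm \<alpha> a b\<close> is \<open>m_\<alpha>^{a,b}\<close>.
\<close>

datatype coord =
    Cx | Cy | Cz | Ct
  | Cu nat nat
  | Cuy nat nat nat
  | Cuz nat nat nat
  | Cq nat nat nat
  | Cm nat nat nat
  | Cr nat nat nat

type_synonym point = "coord \<Rightarrow> real"


section \<open>Smooth functions and Laurent polynomials of finitely many coordinates\<close>

definition depends_only_on :: "coord set \<Rightarrow> (point \<Rightarrow> real) \<Rightarrow> bool" where
  "depends_only_on S f \<longleftrightarrow> (\<forall>p p'. (\<forall>c\<in>S. p c = p' c) \<longrightarrow> f p = f p')"

definition partial_deriv :: "coord \<Rightarrow> (point \<Rightarrow> real) \<Rightarrow> point \<Rightarrow> real" where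
  "partial_deriv c f = (\<lambda>p. deriv (\<lambda>s. f (p(c := s))) (p c))"

text \<open>
  All iterated partial derivatives exist and are continuous. Continuity refers to the product
  topology on \<^typ>\<open>point\<close>; for a function of finitely many coordinates this is ordinary joint
  continuity in these coordinates.
\<close>

definition smooth :: "(point \<Rightarrow> real) \<Rightarrow> bool" where
  "smooth f \<longleftrightarrow> (\<forall>cs. continuous_on UNIV (foldr partial_deriv cs f) \<and>
     (\<forall>c p. (\<lambda>s. foldr partial_deriv cs f (p(c := s))) differentiable (at (p c))))"

definition smooth_functions :: "(point \<Rightarrow> real) set" where
  "smooth_functions = {f. smooth f \<and> (\<exists>S. finite S \<and> depends_only_on S f)}"

text \<open>
  Since \<open>inverse 0 = 0\<close> in HOL, these are total functions; their values where an inverted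
  coordinate vanishes are irrelevant because of the identification made below.
\<close>

definition laurent_polynomials :: "(point \<Rightarrow> real) set" where
  "laurent_polynomials =
     {f. \<exists>S E a. finite (S :: coord set) \<and> finite (E :: (coord \<Rightarrow> int) set) \<and>
           f = (\<lambda>p. \<Sum>e\<in>E. a e * (\<Prod>c\<in>S. p c powi e c))}"


section \<open>The algebra generated by them\<close>

inductive_set alg_fun :: "(point \<Rightarrow> real) set" where
  laurent: "f \<in> laurent_polynomials \<Longrightarrow> f \<in> alg_fun"
| smooth: "f \<in> smooth_functions \<Longrightarrow> f \<in> alg_fun"
| add: "f \<in> alg_fun \<Longrightarrow> g \<in> alg_fun \<Longrightarrow> (\<lambda>p. f p + g p) \<in> alg_fun"
| mult: "f \<in> alg_fun \<Longrightarrow> g \<in> alg_fun \<Longrightarrow> (\<lambda>p. f p * g p) \<in> alg_fun"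
| scale: "f \<in> alg_fun \<Longrightarrow> (\<lambda>p. a * f p) \<in> alg_fun"

definition agree_densely :: "(point \<Rightarrow> real) \<Rightarrow> (point \<Rightarrow> real) \<Rightarrow> bool" where
  "agree_densely f g \<longleftrightarrow> (\<exists>D. open D \<and> closure D = UNIV \<and> (\<forall>p\<in>D. f p = g p))"

lemma agree_densely_refl: "agree_densely f f"
  unfolding agree_densely_def by (rule exI[of _ UNIV]) auto

lemma agree_densely_sym: "agree_densely f g \<Longrightarrow> agree_densely g f"
  unfolding agree_densely_def by metis

lemma open_dense_Int:
  fixes D D' :: "'a::topological_space set"
  assumes "open D" "closure D = UNIV" "closure D' = UNIV"
  shows "closure (D \<inter> D') = UNIV"
proof -
  have "D \<subseteq> closure (D \<inter> D')"
    using open_Int_closure_subset[OF assms(1), of D'] assms(3) by simp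
  then have "closure D \<subseteq> closure (D \<inter> D')"
    by (simp add: closure_minimal)
  with assms(2) show ?thesis by auto
qed

lemma agree_densely_combine:
  assumes "agree_densely f f'" "agree_densely g g'"
    and "\<And>p. f p = f' p \<Longrightarrow> g p = g' p \<Longrightarrow> h p = h' p"
  shows "agree_densely h h'"
proof -
  obtain D D' where "open D" "closure D = UNIV" "\<forall>p\<in>D. f p = f' p"
    and "open D'" "closure D' = UNIV" "\<forall>p\<in>D'. g p = g' p"
    using assms(1,2) unfolding agree_densely_def by auto
  then show ?thesis
    unfolding agree_densely_def using open_dense_Int[of D D'] assms(3)
    by (intro exI[of _ "D \<inter> D'"]) auto
qed

lemma laurent_monomial: "(\<lambda>p. a * p c powi n) \<in> alg_fun"
proof -
  have "(\<lambda>p. a * p c powi n) \<in> laurent_polynomials"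
    unfolding laurent_polynomials_def
    by (rule CollectI, rule exI[of _ "{c}"], rule exI[of _ "{\<lambda>_. n}"], rule exI[of _ "\<lambda>_. a"]) simp
  then show ?thesis by (rule alg_fun.laurent)
qed

lemma const_alg_fun: "(\<lambda>p. a) \<in> alg_fun"
  using laurent_monomial[of a Cx 0] by simp

quotient_type alg = "point \<Rightarrow> real" /
  partial: "\<lambda>f g. f \<in> alg_fun \<and> g \<in> alg_fun \<and> agree_densely f g"
proof (rule part_equivpI)
  show "\<exists>f. f \<in> alg_fun \<and> f \<in> alg_fun \<and> agree_densely f f"
    using const_alg_fun agree_densely_refl by blast
  show "symp (\<lambda>f g. f \<in> alg_fun \<and> g \<in> alg_fun \<and> agree_densely f g)"
    by (auto intro!: sympI agree_densely_sym)
  show "transp (\<lambda>f g. f \<in> alg_fun \<and> g \<in> alg_fun \<and> agree_densely f g)"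
    by (auto intro!: transpI elim: agree_densely_combine)
qed

instantiation alg :: "{comm_ring_1, real_algebra_1}"
begin

lift_definition zero_alg :: alg is "\<lambda>p. 0"
  by (simp add: const_alg_fun agree_densely_refl)

lift_definition one_alg :: alg is "\<lambda>p. 1"
  by (simp add: const_alg_fun agree_densely_refl)

lift_definition plus_alg :: "alg \<Rightarrow> alg \<Rightarrow> alg" is "\<lambda>f g p. f p + g p"
  by (auto intro: alg_fun.add elim: agree_densely_combine)

lift_definition times_alg :: "alg \<Rightarrow> alg \<Rightarrow> alg" is "\<lambda>f g p. f p * g p"
  by (auto intro: alg_fun.mult elim: agree_densely_combine)

lift_definition scaleR_alg :: "real \<Rightarrow> alg \<Rightarrow> alg" is "\<lambda>a f p. a * f p"
  by (auto intro: alg_fun.scale elim: agree_densely_combine[OF _ agree_densely_refl])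

definition uminus_alg :: "alg \<Rightarrow> alg" where
  "uminus_alg f = (-1) *\<^sub>R f"

definition minus_alg :: "alg \<Rightarrow> alg \<Rightarrow> alg" where
  "minus_alg f g = f + (- g)"

lemma zero_neq_one_alg: "(0::alg) \<noteq> 1"
  by transfer (auto simp: agree_densely_def)

instance
proof
  fix a b c :: alg and x y :: real
  note intros = alg_fun.add alg_fun.mult alg_fun.scale const_alg_fun agree_densely_refl
  show "a + b + c = a + (b + c)"
    by transfer (auto simp: add.assoc intro!: intros)
  show "a + b = b + a"
    by transfer (auto simp: add.commute intro!: intros)
  show "0 + a = a"
    by transfer (auto intro!: intros)
  show "- a + a = 0"
    unfolding uminus_alg_def by transfer (auto intro!: intros)
  show "a - b = a + - b"
    by (simp add: minus_alg_def)
  show "a * b * c = a * (b * c)"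
    by transfer (auto simp: mult.assoc intro!: intros)
  show "a * b = b * a"
    by transfer (auto simp: mult.commute intro!: intros)
  show "1 * a = a"
    by transfer (auto intro!: intros)
  show "(a + b) * c = a * c + b * c"
    by transfer (auto simp: distrib_right intro!: intros)
  show "(0::alg) \<noteq> 1"
    by (rule zero_neq_one_alg)
  show "x *\<^sub>R (a + b) = x *\<^sub>R a + x *\<^sub>R b"
    by transfer (auto simp: distrib_left intro!: intros)
  show "(x + y) *\<^sub>R a = x *\<^sub>R a + y *\<^sub>R a"
    by transfer (auto simp: distrib_right intro!: intros)
  show "x *\<^sub>R y *\<^sub>R a = (x * y) *\<^sub>R a"
    by transfer (auto simp: mult.assoc intro!: intros)
  show "a * (b + c) = a * b + a * c"
    by transfer (auto simp: distrib_left intro!: intros)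
  show "a * 1 = a"
    by transfer (auto intro!: intros)
  show "1 *\<^sub>R a = a"
    by transfer (auto intro!: intros)
  show "x *\<^sub>R a * b = x *\<^sub>R (a * b)"
    by transfer (auto simp: mult.assoc intro!: intros)
  show "a * x *\<^sub>R b = x *\<^sub>R (a * b)"
    by transfer (auto simp: mult.left_commute intro!: intros)
qed

end

lift_definition coord_powi :: "coord \<Rightarrow> int \<Rightarrow> alg" is "\<lambda>c n p. p c powi n"
  using laurent_monomial[of 1] by (simp add: agree_densely_refl)

text \<open>The elements \<open>c\<close> and \<open>1/c\<close> of the algebra, for a coordinate \<open>c\<close>.\<close>

abbreviation crd :: "coord \<Rightarrow> alg" where
  "crd c \<equiv> coord_powi c 1"

abbreviation icrd :: "coord \<Rightarrow> alg" where
  "icrd c \<equiv> coord_powi c (- 1)"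

lemma crd_times_icrd: "crd c * icrd c = 1"
proof (transfer)
  fix c
  have "open {p::point. p c \<noteq> 0}"
    by (intro open_Collect_neq continuous_intros continuous_on_product_coordinates)
  moreover have "closure {p::point. p c \<noteq> 0} = UNIV"
  proof -
    have "p \<in> closure {p. p c \<noteq> 0}" if "p c = 0" for p :: point
    proof (rule Lim_in_closed_set)
      have "continuous_on UNIV (\<lambda>s. p(c := s))"
      proof (rule continuous_on_coordinatewise_then_product)
        show "continuous_on UNIV (\<lambda>s. (p(c := s)) i)" for i
          by (cases "i = c") auto
      qed
      moreover have "(\<lambda>n. inverse (real (Suc n))) \<longlonglongrightarrow> 0"
        by (rule LIMSEQ_inverse_real_of_nat)
      ultimately have "(\<lambda>n. p(c := inverse (real (Suc n)))) \<longlonglongrightarrow> p(c := 0)"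
        using continuous_on_tendsto_compose[of UNIV "\<lambda>s. p(c := s)" _ 0] by simp
      moreover have "p(c := 0) = p"
        using that by (metis fun_upd_triv)
      ultimately show "(\<lambda>n. p(c := inverse (real (Suc n)))) \<longlonglongrightarrow> p"
        by simp
      show "\<forall>\<^sub>F n in sequentially. p(c := inverse (real (Suc n))) \<in> closure {p. p c \<noteq> 0}"
        by (intro always_eventually allI subsetD[OF closure_subset]) simp
    qed auto
    moreover have "p \<in> closure {p. p c \<noteq> 0}" if "p c \<noteq> 0" for p :: point
      using that by (intro subsetD[OF closure_subset]) simp
    ultimately show ?thesis by auto
  qed
  ultimately have "agree_densely (\<lambda>p. p c powi 1 * p c powi - 1) (\<lambda>p. 1)"
    unfolding agree_densely_def
    by (intro exI[of _ "{p. p c \<noteq> 0}"]) (auto simp: power_int_minus)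
  then show "(\<lambda>p. p c powi 1 * p c powi - 1) \<in> alg_fun \<and> (\<lambda>p. 1) \<in> alg_fun \<and>
      agree_densely (\<lambda>p. p c powi 1 * p c powi - 1) (\<lambda>p. 1)"
    using alg_fun.mult[OF laurent_monomial[of 1 c 1] laurent_monomial[of 1 c "-1"]]
    by (simp add: const_alg_fun)
qed


section \<open>The functions \<open>q_{\<alpha>,x}\<close>, \<open>m_{\<alpha>,x}\<close>, \<open>r_{\<beta>,x}\<close>\<close>

abbreviation tt :: alg where "tt \<equiv> crd Ct"
abbreviation zz :: alg where "zz \<equiv> crd Cz"
abbreviation ux :: alg where "ux \<equiv> crd (Cu 1 0)"
abbreviation uy :: alg where "uy \<equiv> crd (Cuy 0 0 0)"
abbreviation qx :: "nat \<Rightarrow> alg" where "qx \<alpha> \<equiv> crd (Cq \<alpha> 1 0)"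
abbreviation mx :: "nat \<Rightarrow> alg" where "mx \<alpha> \<equiv> crd (Cm \<alpha> 1 0)"

abbreviation it :: alg where "it \<equiv> icrd Ct"
abbreviation iz :: alg where "iz \<equiv> icrd Cz"
abbreviation iq0x :: alg where "iq0x \<equiv> icrd (Cq 0 1 0)"
abbreviation im0x :: alg where "im0x \<equiv> icrd (Cm 0 1 0)"

fun ry :: "nat \<Rightarrow> alg" where
  "ry 0 = - uy"
| "ry (Suc b) = crd (Cr b 1 0)"

fun rx :: "nat \<Rightarrow> alg" where
  "rx 0 = - ux"
| "rx (Suc b) = ux * rx b - ry b"


section \<open>The module of sequences\<close>

text \<open>
  A sequence \<open>P = [p_0, p_0^q, p_0^m, p_1^r, p_1^q, p_1^m, \<dots>]\<close> is a function on the naturals,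
  with \<open>p_0\<close> at position 0, \<open>p_\<beta>^r\<close> at \<open>3 \<beta>\<close> for \<open>\<beta> \<ge> 1\<close>, \<open>p_\<alpha>^q\<close> at \<open>3 \<alpha> + 1\<close> and \<open>p_\<alpha>^m\<close> at
  \<open>3 \<alpha> + 2\<close>. At index 0, \<open>pr\<close> follows the convention \<open>p_0^r = - p_0\<close>.
\<close>

type_synonym seq = "nat \<Rightarrow> alg"

definition scale_seq :: "alg \<Rightarrow> seq \<Rightarrow> seq" where
  "scale_seq a P = (\<lambda>n. a * P n)"

definition p0 :: "seq \<Rightarrow> alg" where "p0 P = P 0"
definition pq :: "seq \<Rightarrow> nat \<Rightarrow> alg" where "pq P \<alpha> = P (3 * \<alpha> + 1)"
definition pm :: "seq \<Rightarrow> nat \<Rightarrow> alg" where "pm P \<alpha> = P (3 * \<alpha> + 2)"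
definition pr :: "seq \<Rightarrow> nat \<Rightarrow> alg" where
  "pr P \<beta> = (if \<beta> = 0 then - p0 P else P (3 * \<beta>))"

definition mk_seq :: "alg \<Rightarrow> (nat \<Rightarrow> alg) \<Rightarrow> (nat \<Rightarrow> alg) \<Rightarrow> (nat \<Rightarrow> alg) \<Rightarrow> seq" where
  "mk_seq a fq fm fr = (\<lambda>n.
     if n = 0 then a
     else if n mod 3 = 0 then fr (n div 3)
     else if n mod 3 = 1 then fq (n div 3)
     else fm (n div 3))"

definition Rq :: "seq \<Rightarrow> seq" where
  "Rq P = mk_seq
     (ux * p0 P + pr P 1)
     (\<lambda>\<alpha>. qx \<alpha> * p0 P + (if \<alpha> = 0 then 0 else pq P (\<alpha> - 1)))
     (\<lambda>\<alpha>. mx \<alpha> * p0 P - it * (if \<alpha> = 0 then 0 else pm P (\<alpha> - 1)) - zz * it * pm P \<alpha>)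
     (\<lambda>\<beta>. rx \<beta> * p0 P - pr P (\<beta> + 1))"

definition Rm :: "seq \<Rightarrow> seq" where
  "Rm P = scale_seq tt (Rq P) + scale_seq zz P"

text \<open>The explicit formulas for the inverse maps; \<open>1/(-z)^k\<close> is written \<open>(- iz) ^ k\<close>.\<close>

definition Rq_inverse :: "seq \<Rightarrow> seq" where
  "Rq_inverse P = mk_seq
     (pq P 0 * iq0x)
     (\<lambda>\<alpha>. - (qx (\<alpha> + 1) * iq0x * pq P 0) + pq P (\<alpha> + 1))
     (\<lambda>\<alpha>. (\<Sum>j\<le>\<alpha>. tt * pm P j * (- iz) ^ (\<alpha> - j + 1))
          - tt * pq P 0 * iq0x * (\<Sum>j\<le>\<alpha>. mx j * (- iz) ^ (\<alpha> - j + 1)))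
     (\<lambda>\<beta>. rx (\<beta> - 1) * iq0x * pq P 0 - pr P (\<beta> - 1))"

definition Rm_inverse :: "seq \<Rightarrow> seq" where
  "Rm_inverse P = mk_seq
     (pm P 0 * it * im0x)
     (\<lambda>\<alpha>. (\<Sum>j\<le>\<alpha>. (- tt) ^ (\<alpha> - j) * pq P j * iz ^ (\<alpha> - j + 1))
          - pm P 0 * im0x * (\<Sum>j\<le>\<alpha>. (- tt) ^ (\<alpha> - j) * qx j * iz ^ (\<alpha> - j + 1)))
     (\<lambda>\<alpha>. mx (\<alpha> + 1) * im0x * pm P 0 - pm P (\<alpha> + 1))
     (\<lambda>\<beta>. - (\<Sum>j<\<beta>. zz ^ (\<beta> - j - 1) * pr P j * it ^ (\<beta> - j))
          + pm P 0 * im0x *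
            (- (zz ^ \<beta> * it ^ (\<beta> + 1)) + (\<Sum>j=1..\<beta>. zz ^ (\<beta> - j) * rx (j - 1) * it ^ (\<beta> - j + 1))))"

end

theory Submission
  imports Defs
begin

text \<open>
  Solving \<open>\<R>\<^sup>q P = Q\<close> and \<open>\<R>\<^sup>m P = Q\<close> component by component gives first-order linear recurrences
  in the index; the sums in the inverse maps are their solutions. Once both maps are known to be
  invertible, everything commutes because \<open>\<R>\<^sup>m\<close> is a linear polynomial in the linear map \<open>\<R>\<^sup>q\<close>.
\<close>

section \<open>Components of sequences\<close>

lemma p0_mk_seq [simp]: "p0 (mk_seq a fq fm fr) = a"
  by (simp add: p0_def mk_seq_def)

lemma pq_mk_seq [simp]: "pq (mk_seq a fq fm fr) n = fq n"
proof -
  have "(3 * n + 1) mod 3 = 1" "(3 * n + 1) div 3 = n"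
    by presburger+
  then show ?thesis
    by (simp add: pq_def mk_seq_def)
qed

lemma pm_mk_seq [simp]: "pm (mk_seq a fq fm fr) n = fm n"
proof -
  have "(3 * n + 2) mod 3 = 2" "(3 * n + 2) div 3 = n"
    by presburger+
  then show ?thesis
    by (simp add: pm_def mk_seq_def)
qed

lemma pr_mk_seq: "pr (mk_seq a fq fm fr) n = (if n = 0 then - a else fr n)"
  by (simp add: pr_def p0_def mk_seq_def)

lemma pr_0: "pr P 0 = - p0 P"
  by (simp add: pr_def)

text \<open>Position 0 is covered by the assumption on \<open>pr\<close> at index 0, where
  \<open>pr\<close> is \<open>- p0\<close>; the other positions split by residue modulo 3.\<close>

lemma seq_eqI:
  assumes "\<And>n. pq P n = pq Q n" "\<And>n. pm P n = pm Q n" "\<And>n. pr P n = pr Q n"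
  shows "P = Q"
proof
  fix n :: nat
  have "n = 3 * (n div 3) \<or> n = 3 * (n div 3) + 1 \<or> n = 3 * (n div 3) + 2"
    by presburger
  then consider "n = 0" | k where "n = 3 * k" "k \<noteq> 0" | k where "n = 3 * k + 1" | k where "n = 3 * k + 2"
    by (metis mult_0_right)
  then show "P n = Q n"
  proof cases
    case 1
    then show ?thesis using assms(3)[of 0] by (simp add: pr_def p0_def)
  next
    case (2 k)
    then show ?thesis using assms(3)[of k] by (simp add: pr_def)
  next
    case (3 k)
    then show ?thesis using assms(1)[of k] by (simp add: pq_def)
  next
    case (4 k)
    then show ?thesis using assms(2)[of k] by (simp add: pm_def)
  qed
qed

lemma components_add [simp]:
  "p0 (P + Q) = p0 P + p0 Q" "pq (P + Q) n = pq P n + pq Q n"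
  "pm (P + Q) n = pm P n + pm Q n" "pr (P + Q) n = pr P n + pr Q n"
  by (simp_all add: p0_def pq_def pm_def pr_def)

lemma components_scale_seq [simp]:
  "p0 (scale_seq a P) = a * p0 P" "pq (scale_seq a P) n = a * pq P n"
  "pm (scale_seq a P) n = a * pm P n" "pr (scale_seq a P) n = a * pr P n"
  by (simp_all add: p0_def pq_def pm_def pr_def scale_seq_def)


section \<open>Recurrences\<close>

text \<open>The conventions \<open>pr P 0 = - p0 P\<close> and \<open>rx 0 = - ux\<close> turn the
  formula for the initial component into the case \<open>n = 0\<close> of the last equation.\<close>

lemma Rq_components:
  "pq (Rq P) 0 = qx 0 * p0 P"
  "pq (Rq P) (Suc n) = qx (Suc n) * p0 P + pq P n"
  "pm (Rq P) 0 = mx 0 * p0 P - zz * it * pm P 0"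
  "pm (Rq P) (Suc n) = mx (Suc n) * p0 P - it * pm P n - zz * it * pm P (Suc n)"
  "pr (Rq P) n = rx n * p0 P - pr P (Suc n)"
  by (auto simp: Rq_def pr_mk_seq)

text \<open>
  After sorting by \<open>mult_ac\<close>, \<open>c\<close> and \<open>1/c\<close> may be separated by other factors, which rewriting alone
  does not bridge.
\<close>

lemma crd_cancel:
  "crd c * icrd c = 1" "crd c * (icrd c * a) = a" "crd c * (a * icrd c) = a"
  "crd c * (a * (icrd c * b)) = a * b" "crd c * (a * (b * icrd c)) = a * b"
proof -
  show "crd c * icrd c = 1"
    by (rule crd_times_icrd)
  have cancel: "crd c * x = y" if "x = y * icrd c" for x y
    using that by (metis crd_times_icrd mult.assoc mult.commute mult_1)
  show "crd c * (icrd c * a) = a" "crd c * (a * icrd c) = a"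
    "crd c * (a * (icrd c * b)) = a * b" "crd c * (a * (b * icrd c)) = a * b"
    by (rule cancel; simp add: mult_ac)+
qed

text \<open>In the \<open>pm\<close> components the added \<open>zz\<close> term cancels the one in
  \<open>tt\<close> times \<open>Rq\<close>, leaving a pure shift; instead \<open>zz\<close> now
  appears in \<open>pq\<close> and \<open>pr\<close>.\<close>

lemma Rm_components:
  "pq (Rm P) 0 = tt * qx 0 * p0 P + zz * pq P 0"
  "pq (Rm P) (Suc n) = tt * (qx (Suc n) * p0 P + pq P n) + zz * pq P (Suc n)"
  "pm (Rm P) 0 = tt * mx 0 * p0 P"
  "pm (Rm P) (Suc n) = tt * mx (Suc n) * p0 P - pm P n"
  "pr (Rm P) n = tt * (rx n * p0 P - pr P (Suc n)) + zz * pr P n"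
  by (simp_all add: Rm_def Rq_components crd_cancel algebra_simps)

text \<open>Each old summand gains a factor \<open>c\<close>, and the new one is
  \<open>a (Suc n) * c\<close>.\<close>

lemma convolution_power_Suc:
  fixes a :: "nat \<Rightarrow> 'a::comm_ring_1"
  shows "(\<Sum>j\<le>Suc n. a j * c ^ (Suc n - j + 1)) = c * ((\<Sum>j\<le>n. a j * c ^ (n - j + 1)) + a (Suc n))"
proof -
  have "(\<Sum>j\<le>n. a j * c ^ (Suc n - j + 1)) = c * (\<Sum>j\<le>n. a j * c ^ (n - j + 1))"
    unfolding sum_distrib_left by (rule sum.cong) (auto simp: Suc_diff_le mult_ac)
  then show ?thesis
    by (simp add: algebra_simps)
qed

text \<open>With \<open>p0 (Rq_inverse P)\<close> kept as an unknown, the closed forms become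
  one-step recurrences, and \<open>iq0x\<close> occurs only in the first equation.\<close>

lemma Rq_inverse_components:
  "p0 (Rq_inverse P) = pq P 0 * iq0x"
  "pq (Rq_inverse P) n = pq P (Suc n) - qx (Suc n) * p0 (Rq_inverse P)"
  "pm (Rq_inverse P) 0 = - iz * tt * (pm P 0 - mx 0 * p0 (Rq_inverse P))"
  "pm (Rq_inverse P) (Suc n) =
    - iz * (pm (Rq_inverse P) n + tt * (pm P (Suc n) - mx (Suc n) * p0 (Rq_inverse P)))"
  "pr (Rq_inverse P) (Suc n) = rx n * p0 (Rq_inverse P) - pr P n"
proof -
  let ?s = "pq P 0 * iq0x"
  \<comment> \<open>Merging the two sums gives the shape of \<open>convolution_power_Suc\<close>
    with \<open>c = - iz\<close>.\<close>
  have pm: "pm (Rq_inverse P) n = (\<Sum>j\<le>n. tt * (pm P j - mx j * ?s) * (- iz) ^ (n - j + 1))" for n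
    by (simp add: Rq_inverse_def sum_distrib_left sum_subtractf[symmetric] algebra_simps)
  show p0: "p0 (Rq_inverse P) = ?s"
    by (simp add: Rq_inverse_def)
  show "pq (Rq_inverse P) n = pq P (Suc n) - qx (Suc n) * p0 (Rq_inverse P)"
    unfolding p0 by (simp add: Rq_inverse_def algebra_simps)
  show "pm (Rq_inverse P) 0 = - iz * tt * (pm P 0 - mx 0 * p0 (Rq_inverse P))"
    unfolding p0 pm by (simp add: algebra_simps)
  show "pm (Rq_inverse P) (Suc n) =
      - iz * (pm (Rq_inverse P) n + tt * (pm P (Suc n) - mx (Suc n) * p0 (Rq_inverse P)))"
    unfolding p0 pm by (rule convolution_power_Suc)
  show "pr (Rq_inverse P) (Suc n) = rx n * p0 (Rq_inverse P) - pr P n"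
    unfolding p0 by (simp add: Rq_inverse_def pr_mk_seq algebra_simps)
qed

lemma Rm_inverse_components:
  "p0 (Rm_inverse P) = pm P 0 * it * im0x"
  "pm (Rm_inverse P) n = tt * mx (Suc n) * p0 (Rm_inverse P) - pm P (Suc n)"
  "pq (Rm_inverse P) 0 = iz * (pq P 0 - tt * qx 0 * p0 (Rm_inverse P))"
  "pq (Rm_inverse P) (Suc n) =
    iz * (pq P (Suc n) - tt * (qx (Suc n) * p0 (Rm_inverse P) + pq (Rm_inverse P) n))"
  "pr (Rm_inverse P) (Suc n) =
    rx n * p0 (Rm_inverse P) + it * (zz * pr (Rm_inverse P) n - pr P n)"
proof -
  \<comment> \<open>This is \<open>tt * p0 (Rm_inverse P)\<close>, the factor occurring in the
    closed forms.\<close>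
  let ?s = "pm P 0 * im0x"
  show p0: "p0 (Rm_inverse P) = pm P 0 * it * im0x"
    by (simp add: Rm_inverse_def)
  have p0': "tt * p0 (Rm_inverse P) = ?s" "p0 (Rm_inverse P) = it * ?s"
    unfolding p0 by (simp_all add: crd_cancel mult_ac)
  show "pm (Rm_inverse P) n = tt * mx (Suc n) * p0 (Rm_inverse P) - pm P (Suc n)"
    unfolding p0 by (simp add: Rm_inverse_def crd_cancel algebra_simps)
  have pq: "pq (Rm_inverse P) n = (\<Sum>j\<le>n. (- tt) ^ (n - j) * (pq P j - qx j * ?s) * iz ^ (n - j + 1))" for n
    by (simp add: Rm_inverse_def sum_distrib_left sum_subtractf[symmetric] algebra_simps)
  show "pq (Rm_inverse P) 0 = iz * (pq P 0 - tt * qx 0 * p0 (Rm_inverse P))"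
    unfolding pq p0 by (simp add: crd_cancel algebra_simps)
  \<comment> \<open>The powers of \<open>- tt\<close> and \<open>iz\<close> both grow by one, so
    each old summand gains \<open>- tt * iz\<close>; the new summand has exponents 0 and 1.\<close>
  have "(\<Sum>j\<le>n. (- tt) ^ (Suc n - j) * (pq P j - qx j * ?s) * iz ^ (Suc n - j + 1))
      = - tt * iz * pq (Rm_inverse P) n"
    unfolding pq sum_distrib_left
    by (rule sum.cong) (simp_all add: Suc_diff_le mult_ac)
  then have "pq (Rm_inverse P) (Suc n) =
      - tt * iz * pq (Rm_inverse P) n + (pq P (Suc n) - qx (Suc n) * ?s) * iz"
    unfolding pq[of "Suc n"] by simp
  then show "pq (Rm_inverse P) (Suc n) =
      iz * (pq P (Suc n) - tt * (qx (Suc n) * p0 (Rm_inverse P) + pq (Rm_inverse P) n))"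
    unfolding p0'(1)[symmetric] by (simp add: algebra_simps)
  \<comment> \<open>Shifting \<open>j\<close> merges the two sums, and \<open>n = 0\<close> also fits, as \<open>pr\<close> at \<open>0\<close> is \<open>- p0\<close>.\<close>
  have pr: "pr (Rm_inverse P) n = - (zz ^ n * it ^ (n + 1)) * ?s +
      (\<Sum>j<n. zz ^ (n - Suc j) * (rx j * ?s - pr P j) * it ^ (n - j))" for n
  proof -
    have "(\<Sum>j=1..n. zz ^ (n - j) * rx (j - 1) * it ^ (n - j + 1)) =
        (\<Sum>j<n. zz ^ (n - Suc j) * rx j * it ^ (n - j))"
      by (rule sum.reindex_bij_witness[of _ Suc "\<lambda>j. j - 1"]) (auto simp: Suc_diff_Suc Suc_diff_le)
    then have "pr (Rm_inverse P) n = - (\<Sum>j<n. zz ^ (n - j - 1) * pr P j * it ^ (n - j)) +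
        ?s * (- (zz ^ n * it ^ (n + 1)) + (\<Sum>j<n. zz ^ (n - Suc j) * rx j * it ^ (n - j)))"
      by (simp add: Rm_inverse_def pr_mk_seq mult_ac)
    then show ?thesis
      by (simp add: sum_distrib_left sum_subtractf algebra_simps)
  qed
  \<comment> \<open>The old summands gain \<open>it * zz\<close>, and so does the term outside the
    sum, hence all of \<open>pr (Rm_inverse P) n\<close> does.\<close>
  have "(\<Sum>j<n. zz ^ (Suc n - Suc j) * (rx j * ?s - pr P j) * it ^ (Suc n - j)) =
      it * zz * (\<Sum>j<n. zz ^ (n - Suc j) * (rx j * ?s - pr P j) * it ^ (n - j))"
    unfolding sum_distrib_left
  proof (rule sum.cong)
    fix j assume "j \<in> {..<n}"
    \<comment> \<open>With truncated subtraction the first equation fails at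
      \<open>j = n\<close>.\<close>
    then have "Suc n - Suc j = Suc (n - Suc j)" "Suc n - j = Suc (n - j)"
      by auto
    then show "zz ^ (Suc n - Suc j) * (rx j * ?s - pr P j) * it ^ (Suc n - j) =
        it * zz * (zz ^ (n - Suc j) * (rx j * ?s - pr P j) * it ^ (n - j))"
      by (simp only: power_Suc mult_ac)
  qed simp
  then have "pr (Rm_inverse P) (Suc n) =
      it * zz * pr (Rm_inverse P) n + (rx n * ?s - pr P n) * it"
    unfolding pr by (simp add: algebra_simps)
  then show "pr (Rm_inverse P) (Suc n) =
      rx n * p0 (Rm_inverse P) + it * (zz * pr (Rm_inverse P) n - pr P n)"
    unfolding p0'(2) by (simp add: algebra_simps)
qed


section \<open>Inverse maps\<close>

text \<open>Each recurrence is the matching component equation solved for its newest unknown, so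
  substitution suffices.\<close>

lemma Rq_Rq_inverse: "Rq (Rq_inverse P) = P"
proof (rule seq_eqI)
  show "pq (Rq (Rq_inverse P)) n = pq P n" for n
  proof (cases n)
    case 0
    then show ?thesis
      by (simp add: Rq_components Rq_inverse_components crd_cancel algebra_simps)
  qed (simp add: Rq_components Rq_inverse_components(2))
  show "pm (Rq (Rq_inverse P)) n = pm P n" for n
  proof (cases n)
    case 0
    then show ?thesis
      by (simp add: Rq_components Rq_inverse_components(3) crd_cancel algebra_simps)
  next
    case (Suc k)
    then show ?thesis
      by (simp add: Rq_components Rq_inverse_components(4) crd_cancel algebra_simps)
  qed
  show "pr (Rq (Rq_inverse P)) n = pr P n" for n
    by (simp add: Rq_components Rq_inverse_components(5))
qed

lemma Rq_inverse_Rq: "Rq_inverse (Rq P) = P"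
proof (rule seq_eqI)
  \<comment> \<open>All the other recurrences involve \<open>p0\<close>. Only the one for
    \<open>pm\<close> refers back to its own previous value and so needs induction.\<close>
  have p0: "p0 (Rq_inverse (Rq P)) = p0 P"
    by (simp add: Rq_components Rq_inverse_components(1) crd_cancel algebra_simps)
  show "pq (Rq_inverse (Rq P)) n = pq P n" for n
    by (simp add: Rq_components Rq_inverse_components(2) p0)
  show "pm (Rq_inverse (Rq P)) n = pm P n" for n
  proof (induction n)
    case 0
    then show ?case
      by (simp add: Rq_components Rq_inverse_components(3) p0 crd_cancel algebra_simps)
  next
    case (Suc n)
    then show ?case
      by (simp add: Rq_components Rq_inverse_components(4) p0 crd_cancel algebra_simps)
  qed
  show "pr (Rq_inverse (Rq P)) n = pr P n" for n
    by (cases n) (simp_all add: Rq_components Rq_inverse_components(5) p0 pr_0)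
qed

lemma Rm_Rm_inverse: "Rm (Rm_inverse P) = P"
proof (rule seq_eqI)
  show "pq (Rm (Rm_inverse P)) n = pq P n" for n
  proof (cases n)
    case 0
    then show ?thesis
      by (simp add: Rm_components Rm_inverse_components(3) crd_cancel algebra_simps)
  next
    case (Suc k)
    then show ?thesis
      by (simp add: Rm_components Rm_inverse_components(4) crd_cancel algebra_simps)
  qed
  show "pm (Rm (Rm_inverse P)) n = pm P n" for n
  proof (cases n)
    case 0
    then show ?thesis
      by (simp add: Rm_components Rm_inverse_components(1) crd_cancel algebra_simps)
  qed (simp add: Rm_components Rm_inverse_components(2))
  show "pr (Rm (Rm_inverse P)) n = pr P n" for n
    by (simp add: Rm_components Rm_inverse_components(5) crd_cancel algebra_simps)
qed

text \<open>Here \<open>pm\<close> is read off directly, while \<open>pq\<close> and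
  \<open>pr\<close> depend on their previous values and need induction.\<close>

lemma Rm_inverse_Rm: "Rm_inverse (Rm P) = P"
proof (rule seq_eqI)
  have p0: "p0 (Rm_inverse (Rm P)) = p0 P"
    by (simp add: Rm_components Rm_inverse_components(1) crd_cancel algebra_simps)
  show "pq (Rm_inverse (Rm P)) n = pq P n" for n
  proof (induction n)
    case 0
    then show ?case
      by (simp add: Rm_components Rm_inverse_components(3) p0 crd_cancel algebra_simps)
  next
    case (Suc n)
    then show ?case
      by (simp add: Rm_components Rm_inverse_components(4) p0 crd_cancel algebra_simps)
  qed
  show "pm (Rm_inverse (Rm P)) n = pm P n" for n
    by (simp add: Rm_components Rm_inverse_components(2) p0)
  show "pr (Rm_inverse (Rm P)) n = pr P n" for n
  proof (induction n)
    case 0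
    then show ?case
      by (simp add: pr_0 p0)
  next
    case (Suc n)
    then show ?case
      by (simp add: Rm_components Rm_inverse_components(5) p0 crd_cancel algebra_simps)
  qed
qed


section \<open>Linearity and commutation\<close>

lemma module_scale_seq: "module scale_seq"
  by unfold_locales (auto simp: scale_seq_def algebra_simps)

lemma Rq_add: "Rq (P + Q) = Rq P + Rq Q"
  and Rq_scale_seq: "Rq (scale_seq a P) = scale_seq a (Rq P)"
proof -
  show "Rq (P + Q) = Rq P + Rq Q"
  proof (rule seq_eqI)
    show "pq (Rq (P + Q)) n = pq (Rq P + Rq Q) n" for n
      by (cases n) (simp_all add: Rq_components algebra_simps)
    show "pm (Rq (P + Q)) n = pm (Rq P + Rq Q) n" for n
      by (cases n) (simp_all add: Rq_components algebra_simps)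
    show "pr (Rq (P + Q)) n = pr (Rq P + Rq Q) n" for n
      by (simp add: Rq_components algebra_simps)
  qed
  show "Rq (scale_seq a P) = scale_seq a (Rq P)"
  proof (rule seq_eqI)
    show "pq (Rq (scale_seq a P)) n = pq (scale_seq a (Rq P)) n" for n
      by (cases n) (simp_all add: Rq_components algebra_simps)
    show "pm (Rq (scale_seq a P)) n = pm (scale_seq a (Rq P)) n" for n
      by (cases n) (simp_all add: Rq_components algebra_simps)
    show "pr (Rq (scale_seq a P)) n = pr (scale_seq a (Rq P)) n" for n
      by (simp add: Rq_components algebra_simps)
  qed
qed

lemma module_hom_Rq: "module_hom scale_seq scale_seq Rq"
  by (simp add: module_hom_iff module_scale_seq Rq_add Rq_scale_seq)

lemma module_hom_Rm: "module_hom scale_seq scale_seq Rm"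
proof -
  have "Rm (P + Q) = Rm P + Rm Q" for P Q
    by (simp add: Rm_def Rq_add scale_seq_def fun_eq_iff algebra_simps)
  moreover have "Rm (scale_seq a P) = scale_seq a (Rm P)" for a P
    unfolding Rm_def Rq_scale_seq by (simp add: scale_seq_def fun_eq_iff algebra_simps)
  ultimately show ?thesis
    by (simp add: module_hom_iff module_scale_seq)
qed

lemma module_hom_inv:
  assumes "module_hom s s f" "bij f"
  shows "module_hom s s (inv f)"
proof -
  interpret module_hom s s f by fact
  have f_inv: "f (inv f x) = x" for x
    using \<open>bij f\<close> by (simp add: bij_is_surj surj_f_inv_f)
  have inv_f: "inv f (f x) = x" for x
    using \<open>bij f\<close> by (simp add: bij_is_inj)
  show ?thesis
    unfolding module_hom_iff
    using assms(1) by (metis add scale f_inv inv_f module_hom_iff)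
qed

text \<open>Compose the hypothesis with \<open>inv f\<close> on both sides. As \<open>g\<close> is
  arbitrary, it may itself be an inverse map.\<close>

lemma comp_inv_commute:
  assumes "bij f" "f \<circ> g = g \<circ> f"
  shows "inv f \<circ> g = g \<circ> inv f"
proof -
  have "inv f \<circ> g = inv f \<circ> (g \<circ> f) \<circ> inv f"
    using \<open>bij f\<close> by (simp add: fun_eq_iff bij_is_surj surj_f_inv_f)
  also have "\<dots> = inv f \<circ> f \<circ> (g \<circ> inv f)"
    by (simp add: assms(2)[symmetric] comp_assoc)
  finally show ?thesis
    using \<open>bij f\<close> by (simp add: bij_is_inj)
qed

text \<open>By linearity of \<open>Rq\<close> over the algebra, both sides send \<open>P\<close> to
  \<open>tt\<close> times \<open>Rq (Rq P)\<close> plus \<open>zz\<close> times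
  \<open>Rq P\<close>.\<close>

lemma Rq_Rm_commute: "Rq \<circ> Rm = Rm \<circ> Rq"
  by (simp add: fun_eq_iff[where f = "Rq \<circ> Rm"] Rm_def Rq_add Rq_scale_seq)

theorem proposition4:
  shows "bij Rq \<and> bij Rm \<and> inv Rq = Rq_inverse \<and> inv Rm = Rm_inverse \<and>
    (\<forall>F\<in>{Rq, Rm, inv Rq, inv Rm}. module_hom scale_seq scale_seq F) \<and>
    (\<forall>F\<in>{Rq, Rm, inv Rq, inv Rm}. \<forall>G\<in>{Rq, Rm, inv Rq, inv Rm}. F \<circ> G = G \<circ> F)"
proof -
  have bij: "bij Rq" "bij Rm"
    by (rule o_bij[of Rq_inverse], auto simp: fun_eq_iff Rq_Rq_inverse Rq_inverse_Rq)
      (rule o_bij[of Rm_inverse], auto simp: fun_eq_iff Rm_Rm_inverse Rm_inverse_Rm)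
  have inv: "inv Rq = Rq_inverse" "inv Rm = Rm_inverse"
    by (auto intro!: inv_equality simp: Rq_Rq_inverse Rq_inverse_Rq Rm_Rm_inverse Rm_inverse_Rm)
  have hom: "\<forall>F\<in>{Rq, Rm, inv Rq, inv Rm}. module_hom scale_seq scale_seq F"
    using bij by (auto intro: module_hom_Rq module_hom_Rm module_hom_inv)
  note qq = comp_inv_commute[OF bij(1) refl]
  note mm = comp_inv_commute[OF bij(2) refl]
  note iq_m = comp_inv_commute[OF bij(1) Rq_Rm_commute]
  note im_q = comp_inv_commute[OF bij(2) Rq_Rm_commute[symmetric]]
  note iq_im = comp_inv_commute[OF bij(1) im_q[symmetric]]
  \<comment> \<open>All rules sort products in the single order \<open>Rm\<close>,
    \<open>Rq\<close>, \<open>inv Rm\<close>, \<open>inv Rq\<close>, so rewriting terminates with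
    both sides of each pair equal.\<close>
  have comm: "\<forall>F\<in>{Rq, Rm, inv Rq, inv Rm}. \<forall>G\<in>{Rq, Rm, inv Rq, inv Rm}. F \<circ> G = G \<circ> F"
    by (simp only: ball_simps(5,7) Rq_Rm_commute qq mm iq_m im_q iq_im simp_thms)
  show ?thesis
    using bij inv hom comm by (intro conjI)
qed

end
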